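(* Let $X=(X,\succcurlyeq_X)$ be a partially ordered Hilbert space with $\dim X\geq 2$, and $Y=(Y,\succcurlyeq_Y)$ a Hadamard poset with an order-preserving geodesic ray whose Busemann function is $\succcurlyeq_Y$-decreasing. Then $(X,Y)$ has the monotone Lipschitz extension property if, and only if, $\succcurlyeq_X$ is trivial.
   Context: All linear spaces are real. A partial order is a reflexive, transitive, antisymmetric relation; the trivial order is the equality relation. A vector order on a linear space $X$ is a partial order $\succcurlyeq$ such that $x\succcurlyeq y$ implies $\lambda x\succcurlyeq\lambda y$ for all real $\lambda\geq 0$ and $x+z\succcurlyeq y+z$ for all $z\in X$. A partially ordered Hilbert space is a Hilbert space (possibly infinite-dimensional) together with a vector order (not assumed closed), viewed as a metric space via its norm. A Hadamard poset is a complete CAT(0) space $Y$ (in particular uniquely geodesic) together with a partial order $\succcurlyeq$ that is a closed subset of $Y\times Y$ and is geodesically hereditary: $x\succcurlyeq y$ implies $x\succcurlyeq z\succcurlyeq y$ for every $z$ in the geodesic segment $[x,y]$. A geodesic ray in $Y$ is a map $\sigma:[0,\infty)\to Y$ with $d_Y(\sigma(s),\sigma(t))=|s-t|$ for all $s,t\geq 0$; it is order-preserving if $\sigma(s)\succcurlyeq_Y\sigma(t)$ whenever $s\geq t\geq 0$. Its Busemann function is $B_\sigma:Y\to\mathbb{R}$, $B_\sigma(a):=\lim_{t\to\infty}(d_Y(a,\sigma(t))-t)$ (the limit always exists). $B_\sigma$ is $\succcurlyeq_Y$-decreasing if $a\succcurlyeq_Y b$ implies $B_\sigma(a)\leq B_\sigma(b)$.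 A map $f$ between partially ordered sets is order-preserving if $x\succcurlyeq_X y$ implies $f(x)\succcurlyeq_Y f(y)$; a map between metric spaces is 1-Lipschitz if $d_Y(f(x),f(y))\leq d_X(x,y)$ for all $x,y$. The pair $(X,Y)$ has the monotone Lipschitz extension property if for every nonempty $S\subseteq X$ (with the induced metric and order) and every order-preserving 1-Lipschitz map $f:S\to Y$, there is an order-preserving 1-Lipschitz map $F:X\to Y$ with $F|_S=f$. *)

theory Defs
  imports "HOL-Analysis.Analysis"
begin

text \<open>An order relation \<open>R\<close> is read as "greater or equal": \<open>R x y\<close> means \<open>x \<succeq> y\<close>.\<close>

definition partial_order :: "('a \<Rightarrow> 'a \<Rightarrow> bool) \<Rightarrow> bool" where
  "partial_order R \<longleftrightarrow> reflp R \<and> transp R \<and> antisymp R"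

definition vector_order :: "('a::real_vector \<Rightarrow> 'a \<Rightarrow> bool) \<Rightarrow> bool" where
  "vector_order R \<longleftrightarrow> partial_order R
     \<and> (\<forall>x y. \<forall>c\<ge>0. R x y \<longrightarrow> R (c *\<^sub>R x) (c *\<^sub>R y))
     \<and> (\<forall>x y z. R x y \<longrightarrow> R (x + z) (y + z))"

text \<open>The library's \<open>dim UNIV\<close> takes a junk value on infinite-dimensional spaces, so
  dimension at least two is expressed through the size of a (Hamel) basis.\<close>

definition dim_ge_2 :: "'a::real_vector itself \<Rightarrow> bool" where
  "dim_ge_2 _ \<longleftrightarrow>
     (\<exists>B :: 'a set. independent B \<and> span B = UNIV \<and> (infinite B \<or> 2 \<le> card B))"

definition geodesic_segment :: "'a::metric_space set \<Rightarrow> 'a \<Rightarrow> 'a \<Rightarrow> bool" where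
  "geodesic_segment G x y \<longleftrightarrow>
     (\<exists>c :: real \<Rightarrow> 'a. c 0 = x \<and> c (dist x y) = y
        \<and> (\<forall>s\<in>{0..dist x y}. \<forall>t\<in>{0..dist x y}. dist (c s) (c t) = \<bar>s - t\<bar>)
        \<and> G = c ` {0..dist x y})"

text \<open>Pairs of a point on a side \<open>G\<close> from \<open>p\<close> to \<open>q\<close> and its comparison point on the
  Euclidean segment from \<open>p'\<close> to \<open>q'\<close>.\<close>

definition comparison_points ::
  "'a::metric_space set \<Rightarrow> 'a \<Rightarrow> real^2 \<Rightarrow> real^2 \<Rightarrow> ('a \<times> (real^2)) set" where
  "comparison_points G p p' q' =
     {(x, x'). x \<in> G \<and> x' \<in> closed_segment p' q' \<and> dist p' x' = dist p x}"

definition CAT0 :: "'a::metric_space itself \<Rightarrow> bool" where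
  "CAT0 _ \<longleftrightarrow>
     (\<forall>x y :: 'a. \<exists>G. geodesic_segment G x y) \<and>
     (\<forall>(p :: 'a) q r A B C p' q' r'.
        geodesic_segment A p q \<longrightarrow> geodesic_segment B q r \<longrightarrow> geodesic_segment C r p \<longrightarrow>
        dist p' q' = dist p q \<longrightarrow> dist q' r' = dist q r \<longrightarrow> dist r' p' = dist r p \<longrightarrow>
        (let T = comparison_points A p p' q' \<union> comparison_points B q q' r'
                 \<union> comparison_points C r r' p'
         in \<forall>(x, x')\<in>T. \<forall>(y, y')\<in>T. dist x y \<le> dist x' y'))"

definition geodesically_hereditary :: "('a::metric_space \<Rightarrow> 'a \<Rightarrow> bool) \<Rightarrow> bool" where
  "geodesically_hereditary R \<longleftrightarrow>
     (\<forall>x y G. R x y \<longrightarrow> geodesic_segment G x y \<longrightarrow> (\<forall>z\<in>G. R x z \<and> R z y))"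

definition hadamard_poset :: "('a::complete_space \<Rightarrow> 'a \<Rightarrow> bool) \<Rightarrow> bool" where
  "hadamard_poset R \<longleftrightarrow>
     CAT0 TYPE('a) \<and> partial_order R \<and> closed {(x, y). R x y} \<and> geodesically_hereditary R"

text \<open>A ray is a total function on the reals of which only the restriction to
  \<open>{0..}\<close> matters.\<close>

definition geodesic_ray :: "(real \<Rightarrow> 'a::metric_space) \<Rightarrow> bool" where
  "geodesic_ray \<sigma> \<longleftrightarrow> (\<forall>s\<ge>0. \<forall>t\<ge>0. dist (\<sigma> s) (\<sigma> t) = \<bar>s - t\<bar>)"

definition busemann :: "(real \<Rightarrow> 'a::metric_space) \<Rightarrow> 'a \<Rightarrow> real" where
  "busemann \<sigma> a = Lim at_top (\<lambda>t. dist a (\<sigma> t) - t)"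

definition monotone_lipschitz_extension_property ::
  "('a::metric_space \<Rightarrow> 'a \<Rightarrow> bool) \<Rightarrow> ('b::metric_space \<Rightarrow> 'b \<Rightarrow> bool) \<Rightarrow> bool" where
  "monotone_lipschitz_extension_property R Q \<longleftrightarrow>
     (\<forall>S f. S \<noteq> {} \<longrightarrow> monotone_on S R Q f \<longrightarrow> 1-lipschitz_on S f \<longrightarrow>
        (\<exists>F. monotone R Q F \<and> 1-lipschitz_on UNIV F \<and> (\<forall>x\<in>S. F x = f x)))"

end

theory Submission
  imports Defs
begin

text \<open>If the order on \<open>X\<close> is trivial, monotonicity is vacuous and the claim is the theorem of
  Lang and Schroeder that short maps from subsets of a Hilbert space into a complete CAT(0)
  space extend, where short means 1-Lipschitz (\<open>lipschitz_extension_CAT0\<close>). By Zorn's lemma it suffices to add one point \<open>x\<close>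
  (\<open>one_point_extension\<close>): given pairs \<open>(p, q)\<close> of the graph, some \<open>y\<close> must make every
  excess \<open>d(y, q)\<^sup>2 - d(x, p)\<^sup>2\<close> nonpositive. This is a minimax problem. Every finite convex
  combination of excess functions (a \<open>mixture\<close>) is strongly convex, so it has a minimiser, and
  weighing its growth away from the minimiser against the law of cosines in \<open>X\<close> shows that
  its minimum is nonpositive (\<open>mixture_minimum_nonpos\<close>). For mixtures whose minima approach
  the supremum \<open>M\<close> of all such minima, strong convexity makes the minimisers a Cauchy sequence.
  The limit has excess at most \<open>M\<close>, hence at most \<open>0\<close>, for every pair, because
  mixing in a little of the excess function of the pair cannot push the minimum above \<open>M\<close>.

  Conversely, the negative of the Busemann function turns monotone short maps into \<open>Y\<close> into monotone
  short real functions, and sends the ray isometrically onto the half-line. So the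
  extension property yields, for any \<open>a\<close> and \<open>b\<close> with \<open>a\<close> not above \<open>b\<close>, a monotone
  short function on \<open>X\<close> with values \<open>0\<close> at \<open>a\<close> and \<open>d(a, b)\<close> at \<open>b\<close>
  (\<open>monotone_real_function_exists\<close>). Suppose that \<open>p > 0\<close>. If \<open>0\<close> is not above some \<open>b\<close> at an obtuse
  angle to \<open>p\<close>, then moving from \<open>b\<close> in the direction \<open>p\<close> brings one closer to \<open>0\<close> while the
  function, which already attains the largest value that its distance to \<open>0\<close> permits, may not
  decrease. Otherwise the positive cone contains an open half-space, so a monotone continuous
  function is constant on the hyperplanes orthogonal to \<open>p\<close>; in dimension at least two
  this contradicts the values prescribed on a suitable orthogonal pair \<open>0\<close>, \<open>q\<close>
  (\<open>vector_order_trivial_if_separated\<close>).\<close>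

section \<open>Strong convexity of squared distances\<close>

lemma exists_comparison_triangle:
  fixes a b c :: real
  assumes "0 < a" "a \<le> b + c" "b \<le> a + c" "c \<le> a + b"
  shows "\<exists>p q r :: real^2. dist p q = a \<and> dist q r = b \<and> dist r p = c"
proof -
  define u where "u = (a\<^sup>2 + c\<^sup>2 - b\<^sup>2) / (2 * a)"
  define v where "v = sqrt (c\<^sup>2 - u\<^sup>2)"
  have nonneg: "0 \<le> b" "0 \<le> c"
    using assms by linarith+
  have "\<bar>a - c\<bar> \<le> \<bar>b\<bar>" "\<bar>b\<bar> \<le> \<bar>a + c\<bar>"
    using assms nonneg by linarith+
  then have "(a - c)\<^sup>2 \<le> b\<^sup>2" "b\<^sup>2 \<le> (a + c)\<^sup>2"
    by (simp_all only: abs_le_square_iff)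
  then have "\<bar>a\<^sup>2 + c\<^sup>2 - b\<^sup>2\<bar> \<le> c * (2 * a)"
    by (simp add: power2_eq_square algebra_simps abs_le_iff)
  moreover have "\<bar>u\<bar> = \<bar>a\<^sup>2 + c\<^sup>2 - b\<^sup>2\<bar> / (2 * a)"
    using assms(1) by (simp only: u_def abs_divide abs_of_pos mult_pos_pos zero_less_numeral)
  ultimately have "\<bar>u\<bar> \<le> c"
    using assms(1) by (simp only: pos_divide_le_eq mult_pos_pos zero_less_numeral)
  then have "u\<^sup>2 \<le> c\<^sup>2"
    using nonneg(2) by (simp add: abs_le_square_iff[symmetric])
  then have v: "v\<^sup>2 = c\<^sup>2 - u\<^sup>2"
    by (simp add: v_def)
  have u: "2 * a * u = a\<^sup>2 + c\<^sup>2 - b\<^sup>2"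
    using assms(1) by (simp add: u_def)
  let ?q = "vector [a, 0] :: real^2" and ?r = "vector [u, v] :: real^2"
  have "dist 0 ?q = a"
    using assms(1) by (simp add: dist_vec_def L2_set_def sum_2)
  moreover have "(a - u)\<^sup>2 + v\<^sup>2 = b\<^sup>2"
    using u by (simp add: v power2_diff)
  then have "dist ?q ?r = b"
    using nonneg by (simp add: dist_vec_def L2_set_def sum_2 dist_real_def)
  moreover have "dist ?r 0 = c"
    using nonneg by (simp add: dist_vec_def L2_set_def sum_2 v)
  ultimately show ?thesis
    by blast
qed

text \<open>The flat case, in which the inequality that defines strong convexity of squared distances
  is an equality.\<close>

lemma stewart:
  fixes p q r :: "'a::real_inner"
  shows "(dist r ((1 - t) *\<^sub>R p + t *\<^sub>R q))\<^sup>2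
    = (1 - t) * (dist r p)\<^sup>2 + t * (dist r q)\<^sup>2 - t * (1 - t) * (dist p q)\<^sup>2"
proof -
  define u v where "u = r - p" and "v = r - q"
  have "r - ((1 - t) *\<^sub>R p + t *\<^sub>R q) = (1 - t) *\<^sub>R u + t *\<^sub>R v" "p - q = v - u"
    by (simp_all add: u_def v_def algebra_simps)
  moreover have "(norm ((1 - t) *\<^sub>R u + t *\<^sub>R v))\<^sup>2
    = (1 - t) * (norm u)\<^sup>2 + t * (norm v)\<^sup>2 - t * (1 - t) * (norm (v - u))\<^sup>2"
    unfolding power2_norm_eq_inner by (simp add: inner_simps inner_commute algebra_simps)
  ultimately show ?thesis
    by (simp only: dist_norm u_def v_def)
qed

text \<open>Comparison of the vertex \<open>z\<close> with the point that divides the opposite side \<open>[a, b]\<close>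
  in the ratio \<open>t : 1 - t\<close>, followed by Stewart's identity. What matters later is that \<open>m\<close> does
  not depend on \<open>z\<close>, so that the inequality can be averaged over \<open>z\<close>.\<close>

lemma CAT0_strongly_convex:
  fixes a b :: "'y::metric_space"
  assumes "CAT0 TYPE('y)" "0 \<le> t" "t \<le> 1"
  shows "\<exists>m. \<forall>z. (dist z m)\<^sup>2 \<le> (1 - t) * (dist z a)\<^sup>2 + t * (dist z b)\<^sup>2 - t * (1 - t) * (dist a b)\<^sup>2"
proof (cases "a = b")
  case True
  then show ?thesis
    by (intro exI[of _ a]) (simp add: algebra_simps)
next
  case False
  have geod: "\<exists>G. geodesic_segment G x y" for x y :: 'y
    using assms(1) unfolding CAT0_def by blast
  obtain A where A: "geodesic_segment A a b"
    using geod by blast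
  obtain c where c: "c 0 = a" "c (dist a b) = b" "A = c ` {0..dist a b}"
    "\<And>s t. s \<in> {0..dist a b} \<Longrightarrow> t \<in> {0..dist a b} \<Longrightarrow> dist (c s) (c t) = \<bar>s - t\<bar>"
    using A unfolding geodesic_segment_def by blast
  define m where "m = c (t * dist a b)"
  have tD: "t * dist a b \<in> {0..dist a b}"
    using assms by (simp add: mult_left_le_one_le)
  have mA: "m \<in> A"
    using tD by (simp add: m_def c(3))
  have dam: "dist a m = t * dist a b"
    using c(4)[of 0 "t * dist a b"] tD by (simp add: m_def c(1))
  show ?thesis
  proof (intro exI[of _ m] allI)
    fix z
    obtain B C where B: "geodesic_segment B b z" and C: "geodesic_segment C z a"
      using geod by blast
    obtain p q r :: "real^2"
      where tri: "dist p q = dist a b" "dist q r = dist b z" "dist r p = dist z a"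
      using exists_comparison_triangle[of "dist a b" "dist b z" "dist z a"] False
        dist_triangle[of a b z] dist_triangle[of b z a] dist_triangle[of z a b]
      by (auto simp: dist_commute add.commute)
    define m' where "m' = (1 - t) *\<^sub>R p + t *\<^sub>R q"
    have "p - m' = t *\<^sub>R (p - q)"
      by (simp add: m'_def algebra_simps)
    then have "dist p m' = dist a m"
      using assms tri(1) by (simp add: dist_norm dam)
    moreover have "m' \<in> closed_segment p q"
      using assms unfolding closed_segment_def m'_def by blast
    ultimately have 1: "(m, m') \<in> comparison_points A a p q"
      using mA by (simp add: comparison_points_def)
    obtain c' where "c' (dist b z) = z" "B = c' ` {0..dist b z}"
      using B unfolding geodesic_segment_def by blast
    then have "z \<in> B"
      by (metis atLeastAtMost_iff image_eqI order_refl zero_le_dist)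
    then have 2: "(z, r) \<in> comparison_points B b q r"
      using tri by (simp add: comparison_points_def)
    define T where "T = comparison_points A a p q \<union> comparison_points B b q r
      \<union> comparison_points C z r p"
    have all: "\<forall>(x, x')\<in>T. \<forall>(y, y')\<in>T. dist x y \<le> dist x' y'"
      using conjunct2[OF assms(1)[unfolded CAT0_def], rule_format, OF A B C tri]
      by (simp only: Let_def T_def)
    have T: "(m, m') \<in> T" "(z, r) \<in> T"
      using 1 2 by (simp_all add: T_def)
    have "\<forall>(y, y')\<in>T. dist m y \<le> dist m' y'"
      using bspec[OF all T(1)] by simp
    from bspec[OF this T(2)] have "dist m z \<le> dist m' r"
      by simp
    then have "(dist z m)\<^sup>2 \<le> (dist r m')\<^sup>2"
      by (simp add: dist_commute power_mono)
    also have "\<dots> = (1 - t) * (dist z a)\<^sup>2 + t * (dist z b)\<^sup>2 - t * (1 - t) * (dist a b)\<^sup>2"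
      unfolding m'_def stewart using tri by (simp add: dist_commute)
    finally show "(dist z m)\<^sup>2 \<le> (1 - t) * (dist z a)\<^sup>2 + t * (dist z b)\<^sup>2 - t * (1 - t) * (dist a b)\<^sup>2" .
  qed
qed

section \<open>Minimisers of strongly convex functions\<close>

lemma convergent_if_square_dist_le:
  fixes b :: "nat \<Rightarrow> 'y::complete_space"
  assumes "\<And>m n. (dist (b m) (b n))\<^sup>2 \<le> 2 * (1 / real (Suc m) + 1 / real (Suc n))"
  shows "convergent b"
proof -
  have "Cauchy b"
  proof (rule metric_CauchyI)
    fix e :: real assume "0 < e"
    then have "0 < e\<^sup>2 / 4"
      by simp
    then obtain N where N: "1 / real (Suc N) < e\<^sup>2 / 4"
      using nat_approx_posE by blast
    have "dist (b m) (b n) < e" if "N \<le> m" "N \<le> n" for m n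
    proof -
      have "1 / real (Suc m) \<le> 1 / real (Suc N)" "1 / real (Suc n) \<le> 1 / real (Suc N)"
        using that by (auto intro!: divide_left_mono)
      then have "2 * (1 / real (Suc m) + 1 / real (Suc n)) \<le> 4 * (1 / real (Suc N))"
        by (simp del: of_nat_Suc)
      also have "\<dots> < e\<^sup>2"
        using N by (simp del: of_nat_Suc)
      finally have "(dist (b m) (b n))\<^sup>2 < e\<^sup>2"
        using assms[of m n] by (rule order.strict_trans1[rotated])
      then show ?thesis
        using \<open>0 < e\<close> by (simp add: power_less_imp_less_base)
    qed
    then show "\<exists>N. \<forall>m\<ge>N. \<forall>n\<ge>N. dist (b m) (b n) < e"
      by blast
  qed
  then show ?thesis
    by (rule Cauchy_convergent)
qed

lemma le_if_le_scaled:
  fixes A B :: real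
  assumes "\<And>t. 0 < t \<Longrightarrow> t < 1 \<Longrightarrow> (1 - t) * A \<le> B"
  shows "A \<le> B"
proof (rule tendsto_le)
  show "((\<lambda>t. (1 - t) * A) \<longlongrightarrow> A) (at_right 0)"
    by (rule tendsto_eq_intros refl | simp)+
  show "((\<lambda>t. B) \<longlongrightarrow> B) (at_right 0)"
    by simp
  show "\<forall>\<^sub>F t in at_right 0. (1 - t) * A \<le> B"
    using eventually_at_right_less[of 0] eventually_at_right_real[of 0 1]
    by (auto elim!: eventually_mono intro!: assms)
qed simp

text \<open>Two near-minimisers are close, since otherwise their midpoint would have too small a value; this
  gives a minimiser \<open>b\<close>. Comparing \<open>b\<close> with points of \<open>[b, z]\<close> that tend to \<open>b\<close>, and not with the
  midpoint only, gives the growth rate with the sharp constant \<open>1\<close>, on which the sign of the minimum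
  in \<open>mixture_minimum_nonpos\<close> depends.\<close>

lemma strong_minimiser_exists:
  fixes h :: "'y::complete_space \<Rightarrow> real"
  assumes cont: "continuous_on UNIV h"
    and bdd: "\<And>z. L \<le> h z"
    and conv: "\<And>a b t. 0 \<le> t \<Longrightarrow> t \<le> 1 \<Longrightarrow>
      \<exists>m. h m \<le> (1 - t) * h a + t * h b - t * (1 - t) * (dist a b)\<^sup>2"
  shows "\<exists>b. \<forall>z. h b + (dist b z)\<^sup>2 \<le> h z"
proof -
  define I where "I = (INF z. h z)"
  have "bdd_below (range h)"
    using bdd by (rule bdd_belowI2)
  then have I: "I \<le> h z" for z
    unfolding I_def by (simp add: cINF_lower)
  define \<delta> where "\<delta> n = 1 / real (Suc n)" for n
  have "\<exists>a. h a < I + \<delta> n" for n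
  proof (rule ccontr)
    assume "\<not> ?thesis"
    then have "I + \<delta> n \<le> I"
      unfolding I_def[symmetric] by (subst (2) I_def, intro cINF_greatest) (auto simp: not_less)
    then show False
      by (simp add: \<delta>_def)
  qed
  then obtain a where a: "\<And>n. h (a n) < I + \<delta> n"
    by metis
  have "convergent a"
  proof (rule convergent_if_square_dist_le)
    fix m n
    obtain c where "h c \<le> (1/2) * h (a m) + (1/2) * h (a n) - (1/4) * (dist (a m) (a n))\<^sup>2"
      using conv[of "1/2" "a m" "a n"] by auto
    then show "(dist (a m) (a n))\<^sup>2 \<le> 2 * (1 / real (Suc m) + 1 / real (Suc n))"
      using I[of c] a[of m] a[of n] unfolding \<delta>_def[symmetric] by argo
  qed
  then obtain b where b: "a \<longlonglongrightarrow> b"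
    by (auto simp: convergent_def)
  have "(\<lambda>n. h (a n)) \<longlonglongrightarrow> h b"
    using continuous_on_tendsto_compose[OF cont b] by simp
  moreover have "(\<lambda>n. I + \<delta> n) \<longlonglongrightarrow> I + 0"
    unfolding \<delta>_def by (intro tendsto_intros LIMSEQ_Suc[OF lim_1_over_n])
  ultimately have "h b \<le> I + 0"
    by (rule LIMSEQ_le) (use a in \<open>auto intro: less_imp_le\<close>)
  then have hb: "h b \<le> h z" for z
    using I[of z] by simp
  have "(dist b z)\<^sup>2 \<le> h z - h b" for z
  proof (rule le_if_le_scaled)
    fix t :: real assume t: "0 < t" "t < 1"
    then obtain m where "h m \<le> (1 - t) * h b + t * h z - t * (1 - t) * (dist b z)\<^sup>2"
      using conv[of t b z] by auto
    with hb[of m] have "t * ((1 - t) * (dist b z)\<^sup>2) \<le> t * (h z - h b)"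
      by (simp add: algebra_simps)
    then show "(1 - t) * (dist b z)\<^sup>2 \<le> h z - h b"
      using t by simp
  qed
  then show ?thesis
    by (intro exI[of _ b]) (simp add: field_simps)
qed

section \<open>Extending Lipschitz maps from Hilbert spaces to Hadamard spaces\<close>

text \<open>Partial short maps are treated as relations in order to apply Zorn's lemma to inclusion of graphs;
  a short relation is automatically single-valued.\<close>

definition short_relation :: "('x::metric_space \<times> 'y::metric_space) set \<Rightarrow> bool" where
  "short_relation G \<longleftrightarrow> (\<forall>p q p' q'. (p, q) \<in> G \<longrightarrow> (p', q') \<in> G \<longrightarrow> dist q q' \<le> dist p p')"

lemma short_relationD:
  "short_relation G \<Longrightarrow> (p, q) \<in> G \<Longrightarrow> (p', q') \<in> G \<Longrightarrow> dist q q' \<le> dist p p'"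
  unfolding short_relation_def by blast

text \<open>A function \<open>h = (\<Sum>i. \<lambda>\<^sub>i (d(\<cdot>, q\<^sub>i)\<^sup>2 - d(x, p\<^sub>i)\<^sup>2))\<close> with convex weights \<open>\<lambda>\<^sub>i\<close> is recorded
  together with the vector \<open>u = (\<Sum>i. \<lambda>\<^sub>i (p\<^sub>i - x))\<close>. Generating these pairs inductively turns the
  double sums of the usual argument into two inductions, and makes closure under convex
  combinations hold by definition.\<close>

inductive mixture ::
  "('x::real_inner \<times> 'y::metric_space) set \<Rightarrow> 'x \<Rightarrow> ('y \<Rightarrow> real) \<Rightarrow> 'x \<Rightarrow> bool"
  for G x where
  excess: "(p, q) \<in> G \<Longrightarrow> mixture G x (\<lambda>z. (dist z q)\<^sup>2 - (dist x p)\<^sup>2) (p - x)"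
| mix: "mixture G x h u \<Longrightarrow> mixture G x k v \<Longrightarrow> 0 \<le> t \<Longrightarrow> t \<le> 1 \<Longrightarrow>
    mixture G x (\<lambda>z. (1 - t) * h z + t * k z) ((1 - t) *\<^sub>R u + t *\<^sub>R v)"

lemma mixture_continuous: "mixture G x h u \<Longrightarrow> continuous_on UNIV h"
  by (induction rule: mixture.induct) (intro continuous_intros; assumption)+

lemma mixture_bounded_below: "mixture G x h u \<Longrightarrow> \<exists>L. \<forall>z. L \<le> h z"
proof (induction rule: mixture.induct)
  case (excess p q)
  show ?case
    by (intro exI[of _ "- (dist x p)\<^sup>2"]) simp
next
  case (mix h u k v t)
  then obtain L M where "\<And>z. L \<le> h z" "\<And>z. M \<le> k z"
    by blast
  then show ?case
    using mix.hyps by (intro exI[of _ "(1 - t) * L + t * M"]) (auto intro!: add_mono mult_left_mono)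
qed

lemma mixture_strongly_convex:
  assumes "mixture G x h u"
    and "\<And>z. (dist z m)\<^sup>2 \<le> (1 - s) * (dist z a)\<^sup>2 + s * (dist z b)\<^sup>2 - s * (1 - s) * (dist a b)\<^sup>2"
  shows "h m \<le> (1 - s) * h a + s * h b - s * (1 - s) * (dist a b)\<^sup>2"
  using assms(1)
proof (induction rule: mixture.induct)
  case (excess p q)
  show ?case
    using assms(2)[of q] by (simp add: dist_commute algebra_simps)
next
  case (mix h u k v t)
  have "(1 - t) * h m + t * k m
    \<le> (1 - t) * ((1 - s) * h a + s * h b - s * (1 - s) * (dist a b)\<^sup>2)
      + t * ((1 - s) * k a + s * k b - s * (1 - s) * (dist a b)\<^sup>2)"
    using mix by (intro add_mono mult_left_mono) auto
  then show ?case
    by (simp add: algebra_simps)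
qed

lemma mixture_strong_minimiser:
  fixes G :: "('x::real_inner \<times> 'y::complete_space) set"
  assumes "CAT0 TYPE('y)" "mixture G x h u"
  shows "\<exists>b. \<forall>z. h b + (dist b z)\<^sup>2 \<le> h z"
proof -
  have conv: "\<exists>m. h m \<le> (1 - t) * h a + t * h b - t * (1 - t) * (dist a b)\<^sup>2"
    if t: "0 \<le> t" "t \<le> 1" for a b :: 'y and t :: real
  proof -
    obtain m where
      "\<forall>z. (dist z m)\<^sup>2 \<le> (1 - t) * (dist z a)\<^sup>2 + t * (dist z b)\<^sup>2 - t * (1 - t) * (dist a b)\<^sup>2"
      using CAT0_strongly_convex[OF assms(1) t] ..
    then show ?thesis
      by (intro exI[of _ m] mixture_strongly_convex[OF assms(2)]) (rule spec)
  qed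
  obtain L where L: "\<forall>z. L \<le> h z"
    using mixture_bounded_below[OF assms(2)] ..
  show ?thesis
    by (rule strong_minimiser_exists[OF mixture_continuous[OF assms(2)] spec[OF L] conv])
qed

text \<open>For a single excess function this is shortness of \<open>G\<close> combined with the law of cosines in the
  Hilbert space; both sides are affine in the mixture.\<close>

lemma mixture_value_at_target:
  assumes "mixture G x h u" "short_relation G" "(p, q) \<in> G"
  shows "h q \<le> (dist x p)\<^sup>2 - 2 * (u \<bullet> (p - x))"
  using assms(1)
proof (induction rule: mixture.induct)
  case (excess p' q')
  have "dist q q' \<le> dist p p'"
    by (rule short_relationD[OF assms(2,3) excess])
  then have "(dist q q')\<^sup>2 \<le> (dist p p')\<^sup>2"
    by (simp add: power_mono)
  moreover have "(dist p p')\<^sup>2 = (dist x p)\<^sup>2 + (dist x p')\<^sup>2 - 2 * ((p' - x) \<bullet> (p - x))"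
    unfolding dist_norm power2_norm_eq_inner by (simp add: inner_simps inner_commute)
  ultimately show ?case
    by simp
next
  case (mix h u k v t)
  have "(1 - t) * h q + t * k q
    \<le> (1 - t) * ((dist x p)\<^sup>2 - 2 * (u \<bullet> (p - x))) + t * ((dist x p)\<^sup>2 - 2 * (v \<bullet> (p - x)))"
    using mix by (intro add_mono mult_left_mono) auto
  then show ?case
    by (simp add: inner_simps algebra_simps)
qed

text \<open>Averages a bound that is affine in \<open>p\<close> with the weights of the mixture.\<close>

lemma mixture_le_affine:
  assumes "mixture G x h u"
    and "\<And>p q. (p, q) \<in> G \<Longrightarrow> (dist z q)\<^sup>2 - (dist x p)\<^sup>2 \<le> c - 2 * (w \<bullet> (p - x))"
  shows "h z \<le> c - 2 * (w \<bullet> u)"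
  using assms(1)
proof (induction rule: mixture.induct)
  case (excess p q)
  then show ?case
    by (rule assms(2))
next
  case (mix h u k v t)
  have "(1 - t) * h z + t * k z \<le> (1 - t) * (c - 2 * (w \<bullet> u)) + t * (c - 2 * (w \<bullet> v))"
    using mix by (intro add_mono mult_left_mono) auto
  then show ?case
    by (simp add: inner_simps algebra_simps)
qed

text \<open>Growth of \<open>h\<close> away from its minimiser \<open>b\<close> and the bound on \<open>h q\<close> together bound the
  excess of \<open>b\<close> at each pair by \<open>- h b - 2 (u \<bullet> (p - x))\<close>. Averaging with the weights of \<open>h\<close> itself
  gives \<open>h b \<le> - h b - 2 (u \<bullet> u)\<close>.\<close>

lemma mixture_minimum_nonpos:
  assumes "mixture G x h u" "short_relation G"
    and "\<And>z. h b + (dist b z)\<^sup>2 \<le> h z"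
  shows "h b \<le> 0"
proof -
  have "(dist b q)\<^sup>2 - (dist x p)\<^sup>2 \<le> - h b - 2 * (u \<bullet> (p - x))" if "(p, q) \<in> G" for p q
    using mixture_value_at_target[OF assms(1,2) that] assms(3)[of q] by simp
  then have "h b \<le> - h b - 2 * (u \<bullet> u)"
    by (rule mixture_le_affine[OF assms(1)])
  then show ?thesis
    using inner_ge_zero[of u] by linarith
qed

lemma one_point_extension:
  fixes G :: "('x::real_inner \<times> 'y::complete_space) set"
  assumes CAT0: "CAT0 TYPE('y)" and short: "short_relation G" and "G \<noteq> {}"
  shows "\<exists>y. \<forall>(p, q)\<in>G. dist y q \<le> dist x p"
proof -
  \<comment> \<open>\<open>M\<close> is the lower value of the minimax problem: the supremum over mixtures of their minima.\<close>
  define min_at where "min_at h b \<longleftrightarrow> (\<forall>z. h b + (dist b z)\<^sup>2 \<le> h z)" for h :: "'y \<Rightarrow> real" and b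
  define V where "V = {v. \<exists>h u b. mixture G x h u \<and> min_at h b \<and> v = h b}"
  define M where "M = Sup V"
  have min_ex: "\<exists>b. min_at h b" if "mixture G x h u" for h u
    using mixture_strong_minimiser[OF CAT0 that] by (simp add: min_at_def)
  have V_le: "v \<le> 0" if "v \<in> V" for v
  proof -
    obtain h u b where h: "mixture G x h u \<and> min_at h b \<and> v = h b"
      using \<open>v \<in> V\<close> unfolding V_def mem_Collect_eq by (elim exE) (rule that)
    then show ?thesis
      using mixture_minimum_nonpos[OF conjunct1[OF h] short, of b] by (simp add: min_at_def)
  qed
  have V_I: "h b \<in> V" if "mixture G x h u" "min_at h b" for h u b
    unfolding V_def mem_Collect_eq
    by (intro exI[of _ h] exI[of _ u] exI[of _ b] conjI that refl)
  obtain p0 q0 where "(p0, q0) \<in> G"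
    using \<open>G \<noteq> {}\<close> by auto
  note ex = mixture.excess[OF this, of x]
  obtain b0 where "min_at (\<lambda>z. (dist z q0)\<^sup>2 - (dist x p0)\<^sup>2) b0"
    using min_ex[OF ex] ..
  from V_I[OF ex this] have "V \<noteq> {}"
    by blast
  then have "M \<le> 0"
    unfolding M_def using V_le by (intro cSup_least)
  have M_ge: "h b \<le> M" if "mixture G x h u" "min_at h b" for h u b
    unfolding M_def using V_I[OF that] V_le by (intro cSup_upper bdd_aboveI)
  define \<delta> where "\<delta> n = 1 / real (Suc n)" for n
  have "\<exists>h u b. mixture G x h u \<and> min_at h b \<and> M - \<delta> n < h b" for n
  proof -
    have "M - \<delta> n < Sup V"
      by (simp add: M_def \<delta>_def)
    then obtain v where v: "v \<in> V" "M - \<delta> n < v"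
      using less_cSupD[OF \<open>V \<noteq> {}\<close>] by blast
    obtain h u b where "mixture G x h u \<and> min_at h b \<and> v = h b"
      using v(1) unfolding V_def mem_Collect_eq by (elim exE) (rule that)
    with v(2) show ?thesis
      by (intro exI[of _ h] exI[of _ u] exI[of _ b]) simp
  qed
  then obtain h u b where h: "\<And>n. mixture G x (h n) (u n)" "\<And>n. min_at (h n) (b n)"
    "\<And>n. M - \<delta> n < h n (b n)"
    by metis
  have lower: "M - \<delta> n + (dist (b n) z)\<^sup>2 \<le> h n z" for n z
  proof -
    have "h n (b n) + (dist (b n) z)\<^sup>2 \<le> h n z"
      using h(2)[of n] unfolding min_at_def by blast
    then show ?thesis
      using h(3)[of n] by linarith
  qed
  \<comment> \<open>The average of two near-optimal mixtures has its minimum at most \<open>M\<close> as well; both of them grow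
    away from their own minimisers, which must therefore be close to the minimiser \<open>c\<close> of the average.\<close>
  have "convergent b"
  proof (rule convergent_if_square_dist_le)
    fix m n
    define k where "k z = (1 - 1/2) * h m z + 1/2 * h n z" for z
    have k: "mixture G x k ((1 - 1/2) *\<^sub>R u m + (1/2) *\<^sub>R u n)"
      unfolding k_def by (rule mixture.mix[OF h(1) h(1)]) simp_all
    obtain c where c: "min_at k c"
      using min_ex[OF k] by blast
    have "k c \<le> M"
      by (rule M_ge[OF k c])
    then have "(dist (b m) c)\<^sup>2 + (dist (b n) c)\<^sup>2 \<le> \<delta> m + \<delta> n"
      using lower[of m c] lower[of n c] unfolding k_def by argo
    moreover have "(dist (b m) (b n))\<^sup>2 \<le> (dist (b m) c + dist (b n) c)\<^sup>2"
      by (simp add: dist_triangle2 power_mono)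
    moreover have "(dist (b m) c + dist (b n) c)\<^sup>2 \<le> 2 * ((dist (b m) c)\<^sup>2 + (dist (b n) c)\<^sup>2)"
      using sum_squares_bound[of "dist (b m) c" "dist (b n) c"] by (simp add: power2_sum)
    ultimately show "(dist (b m) (b n))\<^sup>2 \<le> 2 * (1 / real (Suc m) + 1 / real (Suc n))"
      unfolding \<delta>_def[symmetric] by argo
  qed
  then obtain y where y: "b \<longlonglongrightarrow> y"
    by (auto simp: convergent_def)
  have "dist y q \<le> dist x p" if pq: "(p, q) \<in> G" for p q
  proof -
    have "(dist y q)\<^sup>2 \<le> (dist x p)\<^sup>2"
    proof (rule le_if_le_scaled)
      fix t :: real assume t: "0 < t" "t < 1"
      \<comment> \<open>Here \<open>t\<close> is the weight with which the excess of the pair is mixed into \<open>h n\<close>. It stays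
        fixed as \<open>n\<close> tends to infinity and only then tends to \<open>0\<close>.\<close>
      have bound: "t * ((1 - t) * (dist (b n) q)\<^sup>2) \<le> t * (dist x p)\<^sup>2 + \<delta> n" for n
      proof -
        define k where "k z = (1 - t) * h n z + t * ((dist z q)\<^sup>2 - (dist x p)\<^sup>2)" for z
        have k: "mixture G x k ((1 - t) *\<^sub>R u n + t *\<^sub>R (p - x))"
          unfolding k_def using t by (intro mixture.mix[OF h(1) mixture.excess[OF pq]]) simp_all
        obtain c where c: "min_at k c"
          using min_ex[OF k] by blast
        let ?A = "dist (b n) c" and ?B = "dist c q"
        have "(1 - t) * (M - \<delta> n + ?A\<^sup>2) \<le> (1 - t) * h n c"
          using lower[of n c] t by (intro mult_left_mono) auto
        then have "(1 - t) * (M - \<delta> n + ?A\<^sup>2) + t * (?B\<^sup>2 - (dist x p)\<^sup>2) \<le> M"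
          using M_ge[OF k c] unfolding k_def by argo
        then have "(1 - t) * ?A\<^sup>2 + t * ?B\<^sup>2 \<le> t * (dist x p)\<^sup>2 + t * M + (1 - t) * \<delta> n"
          by (simp add: algebra_simps)
        also have "\<dots> \<le> t * (dist x p)\<^sup>2 + \<delta> n"
        proof -
          have "t * M \<le> 0"
            using t \<open>M \<le> 0\<close> by (simp add: mult_le_0_iff)
          moreover have "(1 - t) * \<delta> n \<le> 1 * \<delta> n"
            using t by (intro mult_right_mono) (auto simp: \<delta>_def)
          ultimately show ?thesis
            by linarith
        qed
        finally have *: "(1 - t) * ?A\<^sup>2 + t * ?B\<^sup>2 \<le> t * (dist x p)\<^sup>2 + \<delta> n" .
        \<comment> \<open>The minimiser \<open>c\<close> is eliminated: weighted squared distances from \<open>c\<close> to two points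
          are at least what they are at the best point between them.\<close>
        have "(1 - t) * ?A\<^sup>2 + t * ?B\<^sup>2 - t * ((1 - t) * (?A + ?B)\<^sup>2) = ((1 - t) * ?A - t * ?B)\<^sup>2"
          by (simp add: power2_eq_square algebra_simps)
        then have "t * ((1 - t) * (?A + ?B)\<^sup>2) \<le> (1 - t) * ?A\<^sup>2 + t * ?B\<^sup>2"
          by (metis diff_ge_0_iff_ge zero_le_power2)
        moreover have "t * ((1 - t) * (dist (b n) q)\<^sup>2) \<le> t * ((1 - t) * (?A + ?B)\<^sup>2)"
          using t by (intro mult_left_mono power_mono dist_triangle) auto
        ultimately show ?thesis
          using * by linarith
      qed
      have "(\<lambda>n. t * ((1 - t) * (dist (b n) q)\<^sup>2)) \<longlonglongrightarrow> t * ((1 - t) * (dist y q)\<^sup>2)"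
        by (intro tendsto_intros y)
      moreover have "(\<lambda>n. t * (dist x p)\<^sup>2 + \<delta> n) \<longlonglongrightarrow> t * (dist x p)\<^sup>2 + 0"
        unfolding \<delta>_def by (intro tendsto_intros LIMSEQ_Suc[OF lim_1_over_n])
      ultimately have "t * ((1 - t) * (dist y q)\<^sup>2) \<le> t * (dist x p)\<^sup>2 + 0"
        by (rule LIMSEQ_le) (use bound in blast)
      then show "(1 - t) * (dist y q)\<^sup>2 \<le> (dist x p)\<^sup>2"
        using t by simp
    qed
    then show ?thesis
      by (rule power2_le_imp_le) simp
  qed
  then show ?thesis
    by blast
qed

text \<open>A maximal short relation that contains the graph of \<open>f\<close> is total by the one-point extension.\<close>

theorem lipschitz_extension_CAT0:
  fixes f :: "'x::real_inner \<Rightarrow> 'y::complete_space"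
  assumes "CAT0 TYPE('y)" "S \<noteq> {}" "1-lipschitz_on S f"
  shows "\<exists>F. 1-lipschitz_on UNIV F \<and> (\<forall>x\<in>S. F x = f x)"
proof -
  define \<A> where "\<A> = {G. short_relation G \<and> (\<lambda>x. (x, f x)) ` S \<subseteq> G}"
  have "(\<lambda>x. (x, f x)) ` S \<in> \<A>"
    using lipschitz_onD[OF assms(3)] by (auto simp: \<A>_def short_relation_def)
  then have "\<exists>G\<in>\<A>. \<forall>H\<in>\<A>. G \<subseteq> H \<longrightarrow> H = G"
  proof (intro subset_Zorn_nonempty)
    fix \<C> assume \<C>: "\<C> \<noteq> {}" "subset.chain \<A> \<C>"
    have "short_relation (\<Union>\<C>)"
      unfolding short_relation_def
    proof (intro allI impI, elim UnionE)
      fix p q p' q' G G' assume G: "G \<in> \<C>" "(p, q) \<in> G" "G' \<in> \<C>" "(p', q') \<in> G'"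
      obtain H where "H \<in> \<C>" "(p, q) \<in> H" "(p', q') \<in> H"
        using subset.chain_total[OF \<C>(2) G(1,3)] G by blast
      moreover from this have "short_relation H"
        using \<C>(2) unfolding subset_chain_def \<A>_def by blast
      ultimately show "dist q q' \<le> dist p p'"
        by (intro short_relationD)
    qed
    moreover have "(\<lambda>x. (x, f x)) ` S \<subseteq> \<Union>\<C>"
      using \<C> unfolding subset_chain_def \<A>_def by blast
    ultimately show "\<Union>\<C> \<in> \<A>"
      by (simp add: \<A>_def)
  qed auto
  then obtain G where G: "G \<in> \<A>" and max: "\<And>H. H \<in> \<A> \<Longrightarrow> G \<subseteq> H \<Longrightarrow> H = G"
    by blast
  have short: "short_relation G" and graph: "(\<lambda>x. (x, f x)) ` S \<subseteq> G"
    using G by (simp_all add: \<A>_def)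
  have "\<exists>y. (x, y) \<in> G" for x
  proof -
    have "G \<noteq> {}"
      using graph assms(2) by blast
    then obtain y where y: "\<And>p q. (p, q) \<in> G \<Longrightarrow> dist y q \<le> dist x p"
      using one_point_extension[OF assms(1) short] by blast
    then have "short_relation (insert (x, y) G)"
      using short by (auto simp: short_relation_def dist_commute)
    then have "insert (x, y) G = G"
      using graph by (intro max) (auto simp: \<A>_def)
    then show ?thesis
      by blast
  qed
  then obtain F where F: "\<And>x. (x, F x) \<in> G"
    by metis
  have D: "dist q q' \<le> dist p p'" if "(p, q) \<in> G" "(p', q') \<in> G" for p q p' q'
    by (rule short_relationD[OF short that])
  have "1-lipschitz_on UNIV F"
    by (rule lipschitz_onI) (use D F in auto)
  moreover have "F x = f x" if "x \<in> S" for x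
    using D[OF F[of x], of x "f x"] graph that by auto
  ultimately show ?thesis
    by blast
qed

section \<open>Busemann functions\<close>

text \<open>By the triangle inequality, \<open>d(a, \<sigma> t) - t\<close> decreases in \<open>t\<close> and is at least
  \<open>- d(a, \<sigma> 0)\<close>.\<close>

lemma busemann_tendsto:
  assumes "geodesic_ray \<sigma>"
  shows "((\<lambda>t. dist a (\<sigma> t) - t) \<longlongrightarrow> busemann \<sigma> a) at_top"
proof -
  let ?f = "\<lambda>t. dist a (\<sigma> t) - t"
  have ray: "dist (\<sigma> s) (\<sigma> t) = \<bar>s - t\<bar>" if "0 \<le> s" "0 \<le> t" for s t
    using assms that by (simp add: geodesic_ray_def)
  have dec: "?f t \<le> ?f s" if "0 \<le> s" "s \<le> t" for s t
    using dist_triangle[of a "\<sigma> t" "\<sigma> s"] ray[of s t] that by simp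
  have low: "- dist a (\<sigma> 0) \<le> ?f t" if "0 \<le> t" for t
    using dist_triangle[of "\<sigma> 0" "\<sigma> t" a] ray[of 0 t] that by (simp add: dist_commute)
  have bdd: "bdd_below (?f ` {0..})"
    using low by (intro bdd_belowI) auto
  have "(?f \<longlongrightarrow> (INF t\<in>{0..}. ?f t)) at_top"
  proof (rule decreasing_tendsto)
    show "\<forall>\<^sub>F t in at_top. (INF t\<in>{0..}. ?f t) \<le> ?f t"
      using eventually_ge_at_top[of 0]
      by eventually_elim (intro cINF_lower bdd, simp)
  next
    fix c assume "(INF t\<in>{0..}. ?f t) < c"
    then obtain s where s: "0 \<le> s" "?f s < c"
      using cINF_less_iff[OF _ bdd] by auto
    show "\<forall>\<^sub>F t in at_top. ?f t < c"
      using eventually_ge_at_top[of s]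
      by eventually_elim (use s dec in force)
  qed
  then show ?thesis
    unfolding busemann_def by (simp add: tendsto_Lim)
qed

lemma busemann_le:
  assumes "geodesic_ray \<sigma>"
  shows "busemann \<sigma> a \<le> busemann \<sigma> b + dist a b"
proof (rule tendsto_le)
  show "((\<lambda>t. (dist b (\<sigma> t) - t) + dist a b) \<longlongrightarrow> busemann \<sigma> b + dist a b) at_top"
    by (intro tendsto_intros busemann_tendsto assms)
  show "((\<lambda>t. dist a (\<sigma> t) - t) \<longlongrightarrow> busemann \<sigma> a) at_top"
    by (rule busemann_tendsto[OF assms])
  show "\<forall>\<^sub>F t in at_top. dist a (\<sigma> t) - t \<le> (dist b (\<sigma> t) - t) + dist a b"
    using dist_triangle[of a _ b] by (auto simp: algebra_simps)
qed simp

lemma busemann_on_ray: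
  assumes "geodesic_ray \<sigma>" "0 \<le> s"
  shows "busemann \<sigma> (\<sigma> s) = - s"
proof (rule tendsto_unique)
  show "((\<lambda>t. dist (\<sigma> s) (\<sigma> t) - t) \<longlongrightarrow> busemann \<sigma> (\<sigma> s)) at_top"
    by (rule busemann_tendsto[OF assms(1)])
  have "\<forall>\<^sub>F t in at_top. dist (\<sigma> s) (\<sigma> t) - t = - s"
    using eventually_ge_at_top[of s]
    by eventually_elim (use assms in \<open>auto simp: geodesic_ray_def\<close>)
  then show "((\<lambda>t. dist (\<sigma> s) (\<sigma> t) - t) \<longlongrightarrow> - s) at_top"
    by (rule tendsto_eventually)
qed simp

section \<open>The extension property forces the order to be trivial\<close>

text \<open>The two points are sent to \<open>\<sigma> 0\<close> and \<open>\<sigma> (d(a, b))\<close>. This is monotone on \<open>{a, b}\<close> because the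
  only relation that it would violate, \<open>a\<close> above \<open>b\<close>, is excluded. The extension composed with
  the negative of the Busemann function is the required \<open>g\<close>.\<close>

lemma monotone_real_function_exists:
  fixes geX :: "'x::metric_space \<Rightarrow> 'x \<Rightarrow> bool" and geY :: "'y::metric_space \<Rightarrow> 'y \<Rightarrow> bool"
  assumes ext: "monotone_lipschitz_extension_property geX geY"
    and ray: "geodesic_ray \<sigma>" and incr: "monotone_on {0..} (\<ge>) geY \<sigma>"
    and decr: "monotone geY (\<le>) (busemann \<sigma>)"
    and not_ge: "\<not> geX a b"
  shows "\<exists>g. g a = 0 \<and> g b = dist a b \<and> (\<forall>x y. g x \<le> g y + dist x y)
    \<and> (\<forall>x y. geX x y \<longrightarrow> g y \<le> (g x :: real))"
proof -
  define f where "f x = \<sigma> (dist a x)" for x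
  have ge: "geY (\<sigma> s) (\<sigma> t)" if "0 \<le> t" "t \<le> s" for s t
    using monotone_onD[OF incr] that by auto
  have "monotone_on {a, b} geX geY f"
    using not_ge by (auto intro!: monotone_onI ge simp: f_def)
  moreover have "1-lipschitz_on {a, b} f"
    using ray by (intro lipschitz_onI) (auto simp: f_def geodesic_ray_def dist_commute)
  ultimately obtain F where F: "monotone geX geY F" "1-lipschitz_on UNIV F"
      "\<forall>x\<in>{a, b}. F x = f x"
    using ext[unfolded monotone_lipschitz_extension_property_def, rule_format, of "{a, b}" f]
    by auto
  define g where "g x = - busemann \<sigma> (F x)" for x
  have "g a = 0" "g b = dist a b"
    using busemann_on_ray[OF ray] by (simp_all add: g_def F(3) f_def)
  moreover have "g x \<le> g y + dist x y" for x y
    using busemann_le[OF ray, of "F y" "F x"] lipschitz_onD[OF F(2), of y x]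
    by (simp add: g_def dist_commute)
  moreover have "g y \<le> g x" if "geX x y" for x y
    using monotoneD[OF decr monotoneD[OF F(1) that]] by (simp add: g_def)
  ultimately show ?thesis
    by blast
qed

text \<open>Otherwise every vector equals its projection to the line through \<open>p\<close>.\<close>

lemma exists_orthogonal:
  fixes p :: "'x::real_inner"
  assumes "dim_ge_2 TYPE('x)" "p \<noteq> 0"
  shows "\<exists>q. q \<noteq> 0 \<and> q \<bullet> p = 0"
proof (rule ccontr)
  assume no: "\<not> ?thesis"
  have "v \<in> span {p}" for v
  proof -
    have "(v - ((v \<bullet> p) / (p \<bullet> p)) *\<^sub>R p) \<bullet> p = 0"
      using assms(2) by (simp add: inner_simps)
    then have "v = ((v \<bullet> p) / (p \<bullet> p)) *\<^sub>R p"
      using no by (metis eq_iff_diff_eq_0)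
    then show ?thesis
      by (metis span_base span_scale singletonI)
  qed
  then have "B \<subseteq> span {p}" for B
    by blast
  moreover obtain B :: "'x set" where "independent B" "infinite B \<or> 2 \<le> card B"
    using assms(1) unfolding dim_ge_2_def by blast
  ultimately show False
    using independent_span_bound[of "{p}" B] by auto
qed

text \<open>With \<open>a = 0\<close>, the function \<open>g\<close> is as large at \<open>b\<close> as shortness permits. The point \<open>b\<close>
  is chosen so that some point strictly closer to \<open>0\<close> lies above \<open>b\<close>. If all vectors that make
  an acute angle with a positive \<open>p\<close> are positive, such a \<open>b\<close> is found orthogonal to
  \<open>p\<close>.\<close>

lemma vector_order_trivial_if_separated:
  fixes ge :: "'x::real_inner \<Rightarrow> 'x \<Rightarrow> bool"
  assumes ge: "vector_order ge" and dim: "dim_ge_2 TYPE('x)"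
    and sep: "\<And>a b. \<not> ge a b \<Longrightarrow> \<exists>g. g a = 0 \<and> g b = dist a b
      \<and> (\<forall>x y. g x \<le> g y + dist x y) \<and> (\<forall>x y. ge x y \<longrightarrow> g y \<le> (g x :: real))"
  shows "ge = (=)"
proof -
  have refl: "ge x x" and anti: "ge x y \<Longrightarrow> ge y x \<Longrightarrow> x = y"
    and shift: "ge x y \<Longrightarrow> ge (x + z) (y + z)"
    and scale: "0 \<le> r \<Longrightarrow> ge x y \<Longrightarrow> ge (r *\<^sub>R x) (r *\<^sub>R y)"
    for x y z r
    using ge unfolding vector_order_def partial_order_def
    by (auto dest: reflpD antisympD)
  have "x = y" if "ge x y" for x y
  proof (rule ccontr)
    assume "x \<noteq> y"
    define p where "p = x - y"
    have p: "p \<noteq> 0" "0 < p \<bullet> p"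
      using \<open>x \<noteq> y\<close> by (simp_all add: p_def)
    have "ge p 0"
      using shift[OF that, of "- y"] by (simp add: p_def)
    then have up: "ge (s *\<^sub>R p) 0" if "0 \<le> s" for s
      using scale[OF that] by fastforce
    show False
    proof (cases "\<forall>c. 0 < c \<bullet> p \<longrightarrow> ge c 0")
      case False
      then obtain c where c: "0 < c \<bullet> p" "\<not> ge c 0"
        by blast
      then have "\<not> ge 0 (- c)"
        using shift[of 0 "- c" c] by auto
      then obtain g where g: "g 0 = 0" "g (- c) = dist 0 (- c)"
          "\<And>x y. g x \<le> g y + dist x y" "\<And>x y. ge x y \<Longrightarrow> g y \<le> (g x :: real)"
        using sep by blast
      \<comment> \<open>With this \<open>s\<close>, \<open>s *\<^sub>R p\<close> is the orthogonal projection of \<open>c\<close> to the line through \<open>p\<close>,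
        so \<open>s *\<^sub>R p - c\<close> is the shortest vector reached from \<open>- c\<close> along \<open>p\<close>.\<close>
      define s where "s = (c \<bullet> p) / (p \<bullet> p)"
      have "0 \<le> s"
        using c p by (simp add: s_def)
      then have "norm c \<le> g (s *\<^sub>R p - c)"
        using g(4)[OF shift[OF up, of s "- c"]] g(2) by simp
      also have "\<dots> \<le> norm (s *\<^sub>R p - c)"
        using g(3)[of "s *\<^sub>R p - c" 0] g(1) by simp
      finally have "(norm c)\<^sup>2 \<le> (norm (s *\<^sub>R p - c))\<^sup>2"
        by (simp add: power_mono)
      also have "\<dots> = (norm c)\<^sup>2 - s * (c \<bullet> p)"
      proof -
        have "s * (p \<bullet> p) = c \<bullet> p"
          using p by (simp add: s_def)
        then have "s * (s * (p \<bullet> p)) = s * (c \<bullet> p)"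
          by simp
        then show ?thesis
          unfolding power2_norm_eq_inner by (simp add: inner_simps inner_commute algebra_simps)
      qed
      also have "\<dots> < (norm c)\<^sup>2"
        using c p by (simp add: s_def)
      finally show False
        by simp
    next
      case True
      obtain q' where q': "q' \<noteq> 0" "q' \<bullet> p = 0"
        using exists_orthogonal[OF dim p(1)] by blast
      \<comment> \<open>At most one of \<open>q'\<close> and \<open>- q'\<close> lies below \<open>0\<close>, so the sign can be chosen.\<close>
      have "\<not> ge 0 q' \<or> \<not> ge 0 (- q')"
        using anti[of 0 q'] shift[of 0 "- q'" q'] q' by auto
      then obtain q where q: "q \<noteq> 0" "q \<bullet> p = 0" "\<not> ge 0 q"
        using q' by (metis inner_minus_left neg_0_equal_iff_equal minus_zero)
      then obtain g where g: "g 0 = 0" "g q = dist 0 q"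
          "\<And>x y. g x \<le> g y + dist x y" "\<And>x y. ge x y \<Longrightarrow> g y \<le> (g x :: real)"
        using sep by blast
      \<comment> \<open>Every positive multiple \<open>s *\<^sub>R p\<close> lies above \<open>q\<close>, which forces \<open>g\<close> to be at least \<open>norm q\<close>
        there; \<open>s\<close> is small enough for this point to have norm less than \<open>norm q\<close>.\<close>
      define s where "s = norm q / (2 * norm p)"
      have "0 < s"
        using q p by (simp add: s_def)
      then have "0 < (s *\<^sub>R p - q) \<bullet> p"
        using p q by (simp add: inner_simps)
      then have "ge (s *\<^sub>R p) q"
        using shift[of "s *\<^sub>R p - q" 0 q] True by simp
      then have "norm q \<le> g (s *\<^sub>R p)"
        using g(2,4) by fastforce
      also have "\<dots> \<le> s * norm p"
        using g(3)[of "s *\<^sub>R p" 0] g(1) \<open>0 < s\<close> by simp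
      also have "\<dots> < norm q"
        using q p by (simp add: s_def)
      finally show False
        by simp
    qed
  qed
  then show ?thesis
    using refl by (intro ext iffI) auto
qed

theorem corollary9:
  fixes geX :: "'x::{real_inner, complete_space} \<Rightarrow> 'x \<Rightarrow> bool"
    and geY :: "'y::complete_space \<Rightarrow> 'y \<Rightarrow> bool"
  assumes "vector_order geX"
    and "dim_ge_2 TYPE('x)"
    and "hadamard_poset geY"
    and "\<exists>\<sigma>. geodesic_ray \<sigma> \<and> monotone_on {0..} (\<ge>) geY \<sigma>
           \<and> monotone geY (\<le>) (busemann \<sigma>)"
  shows "monotone_lipschitz_extension_property geX geY \<longleftrightarrow> geX = (=)"
proof
  assume ext: "monotone_lipschitz_extension_property geX geY"
  obtain \<sigma> where "geodesic_ray \<sigma>" "monotone_on {0..} (\<ge>) geY \<sigma>"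
      "monotone geY (\<le>) (busemann \<sigma>)"
    using assms(4) by blast
  then show "geX = (=)"
    by (intro vector_order_trivial_if_separated[OF assms(1,2)]
        monotone_real_function_exists[OF ext])
next
  assume triv: "geX = (=)"
  have CAT0: "CAT0 TYPE('y)" and "reflp geY"
    using assms(3) by (simp_all add: hadamard_poset_def partial_order_def)
  then have "monotone geX geY F" for F
    by (auto intro!: monotoneI simp: triv reflpD)
  then show "monotone_lipschitz_extension_property geX geY"
    unfolding monotone_lipschitz_extension_property_def
    using lipschitz_extension_CAT0[OF CAT0] by blast
qed

end
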